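(* Consider an adversary who corrupts a transaction and originally corrupts at least $n/2$ peers. Under the cyclic zone allocation strategy described in the context, the adversary needs to corrupt at least $m$ new peers with each new transaction to establish a consistent corruption, as long as uncorrupted peers remain.
   Context: There are $n$ peers, $m$ is even and divides $n$, $n'=n/m$. Partition the peers into $2n'$ sets $\nu_1,\dots,\nu_{2n'}$ of $m/2$ peers each. Cyclic zone allocation strategy: place $\nu_2,\dots,\nu_{2n'}$ (in this order) at the vertices of a regular $(2n'-1)$-gon and $\nu_1$ at its center. In successive slots (one per transaction), for $i=2,\dots,2n'$: let $L$ be the line through $\nu_1$ and $\nu_i$; let $M$ be the set of all pairs $(\nu_j,\nu_k)$, $j,k\in\{2,\dots,2n'\}\setminus\{i\}$, such that the line through $\nu_j,\nu_k$ is perpendicular to $L$, together with $(\nu_1,\nu_i)$; the zones of the slot are the sets $\nu_j\cup\nu_k$ for $(\nu_j,\nu_k)\in M$, each of size $m$. After $i=2n'$ the loop restarts at $i=2$. Data and hash values of each transaction are stored zone by zone in such a way that altering the value stored in a zone requires corrupting all peers of that zone. To corrupt a transaction, the adversary corrupts all peers of zones of that slot containing at least $n/2$ peers in total. Corrupted peers remain corrupted. To maintain a consistent corruption (a corrupted hash chain with no hash inconsistencies at the corrupted peers) when a new transaction arrives, in the zones of the new slot every zone that contains a corrupted peer must have its hash value altered, so all its uncorrupted peers must be corrupted. *)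

theory Defs
  imports "HOL-Analysis.Analysis"
begin

text \<open>
  Throughout, \<open>q\<close> stands for the number \<open>n / m\<close> of zones per slot, and the
  \<open>2 * q\<close> groups of peers are indexed by \<open>{1..2 * q}\<close>.
\<close>

text \<open>
  The plane is \<open>complex\<close>. Perpendicularity does not change under similarities, so
  the regular \<open>(2 * q - 1)\<close>-gon is taken to be inscribed in the unit circle, with
  group 2 at the point 1.
\<close>

definition group_pos :: "nat \<Rightarrow> nat \<Rightarrow> complex" where
  "group_pos q j =
     (if j = 1 then 0 else cis (2 * pi * real (j - 2) / real (2 * q - 1)))"

text \<open>
  The lines through groups 1 and \<open>i\<close> and through groups \<open>j\<close> and \<open>k\<close> are perpendicular
  iff their direction vectors are orthogonal. The condition \<open>j \<noteq> k\<close> is needed since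
  the zero vector is orthogonal to everything. Pairs occur in both orders, which does
  not affect the resulting set of zones.
\<close>

definition slot_pairs :: "nat \<Rightarrow> nat \<Rightarrow> (nat \<times> nat) set" where
  "slot_pairs q i = insert (1, i)
     {(j, k). j \<in> {2..2 * q} - {i} \<and> k \<in> {2..2 * q} - {i} \<and> j \<noteq> k \<and>
        orthogonal (group_pos q k - group_pos q j) (group_pos q i - group_pos q 1)}"

text \<open>Slots are counted from 0; the loop index runs cyclically through \<open>2, \<dots>, 2 * q\<close>.\<close>

definition slot_index :: "nat \<Rightarrow> nat \<Rightarrow> nat" where
  "slot_index q t = 2 + t mod (2 * q - 1)"

definition cyclic_zones :: "nat \<Rightarrow> (nat \<Rightarrow> 'p set) \<Rightarrow> nat \<Rightarrow> 'p set set" where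
  "cyclic_zones q \<nu> t = (\<lambda>(j, k). \<nu> j \<union> \<nu> k) ` slot_pairs q (slot_index q t)"

definition corrupts_transaction :: "nat \<Rightarrow> 'p set set \<Rightarrow> 'p set \<Rightarrow> bool" where
  "corrupts_transaction n zones C \<longleftrightarrow>
     (\<exists>Z \<subseteq> zones. C = \<Union> Z \<and> real (card C) \<ge> real n / 2)"

text \<open>
  A zone containing a corrupted peer must have its hash value altered, and altering
  the value stored in a zone requires all peers of that zone to be corrupted.
\<close>

definition consistent_corruption :: "'p set set \<Rightarrow> 'p set \<Rightarrow> bool" where
  "consistent_corruption zones C \<longleftrightarrow> (\<forall>Z \<in> zones. Z \<inter> C \<noteq> {} \<longrightarrow> Z \<subseteq> C)"

text \<open>
  \<open>C 0\<close> is the set of peers corrupted in order to corrupt the transaction of slot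
  \<open>t\<close>, and \<open>C k\<close> is the set of all corrupted peers once the \<open>k\<close>-th subsequent
  transaction (slot \<open>t + k\<close>) has been dealt with, for \<open>k \<le> K\<close>. The adversary may
  corrupt more peers than consistency demands.
\<close>

definition consistent_attack ::
    "'p set \<Rightarrow> (nat \<Rightarrow> 'p set set) \<Rightarrow> nat \<Rightarrow> nat \<Rightarrow> (nat \<Rightarrow> 'p set) \<Rightarrow> bool" where
  "consistent_attack peers zones t K C \<longleftrightarrow>
     corrupts_transaction (card peers) (zones t) (C 0) \<and>
     (\<forall>k<K. C k \<subseteq> C (Suc k) \<and> C (Suc k) \<subseteq> peers \<and>
        consistent_corruption (zones (t + Suc k)) (C (Suc k)))"

end

theory Submission
  imports Defs "HOL-Number_Theory.Cong"
begin

text \<open>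
  Modulo \<open>2 * q - 1\<close>, the slot of group \<open>i\<close> pairs the groups on the polygon by the reflection
  \<open>x \<mapsto> 2 * i - x\<close>, whose fixed point \<open>i\<close> is paired with the centre. The zones of a slot
  therefore partition the peers, and the size of a consistent set is a multiple of \<open>m\<close>. The
  reflections of two successive slots compose to the translation by 2, which acts transitively
  because \<open>2 * q - 1\<close> is odd; so a nonempty set consistent with both slots contains all peers.
  Hence each new transaction forces a proper increase of the corrupted set, by a multiple of \<open>m\<close>.
\<close>

section \<open>Perpendicularity on the polygon as a congruence\<close>

lemma orthogonal_cis_diff_iff:
  "orthogonal (cis b - cis a) (cis c) \<longleftrightarrow> cos (b - c) = cos (a - c)"
  by (auto simp: orthogonal_def inner_complex_def cos_diff algebra_simps)

lemma cong_imp_eq_group: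
  assumes "[int a = int b] (mod int (2 * q - 1))" "a \<in> {2..2 * q}" "b \<in> {2..2 * q}"
  shows "a = b"
proof -
  \<comment> \<open>The shift by 2 moves the labels into \<open>0, ..., 2 * q - 2\<close>, where
    congruent numbers are equal.\<close>
  have "[int a - 2 = int b - 2] (mod int (2 * q - 1))"
    using assms(1) by (intro cong_diff) auto
  then have "int a - 2 = int b - 2"
    using assms(2,3) by (intro cong_less_imp_eq_int[of _ "int (2 * q - 1)"]) auto
  then show ?thesis by simp
qed

lemma cong_double_imp_cong:
  assumes "[2 * x = 2 * y] (mod int (2 * q - 1))" "q > 0"
  shows "[x = y] (mod int (2 * q - 1))"
proof -
  have "coprime (2::int) (int (2 * q - 1))"
    using assms(2) by (simp add: of_nat_diff)
  then show ?thesis using assms(1) cong_mult_lcancel by blast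
qed

text \<open>Orthogonality says that two angles, measured from that of \<open>i\<close>, have equal
  cosines, so they agree up to sign modulo \<open>2 * pi\<close>. Equal signs would force
  \<open>j = k\<close>; opposite signs are the reflection in the axis through
  \<open>i\<close>.\<close>

lemma orthogonal_group_pos_iff:
  assumes "i \<in> {2..2 * q}" "j \<in> {2..2 * q}" "k \<in> {2..2 * q}" "j \<noteq> k"
  shows "orthogonal (group_pos q k - group_pos q j) (group_pos q i - group_pos q 1) \<longleftrightarrow>
    [int j + int k = 2 * int i] (mod int (2 * q - 1))"
proof -
  define N where "N = real (2 * q - 1)"
  have N: "N > 0" using assms(1) by (auto simp: N_def)
  \<comment> \<open>The angle of group \<open>x\<close>, with real instead of truncated subtraction,
    so that it is affine in \<open>x\<close>.\<close>
  define \<theta> where "\<theta> = (\<lambda>x. 2 * pi * (real x - 2) / N)"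
  have pos: "group_pos q x = cis (\<theta> x)" if "x \<in> {2..2 * q}" for x
    using that by (auto simp: group_pos_def \<theta>_def N_def of_nat_diff)
  have pos1: "group_pos q 1 = 0" by (simp add: group_pos_def)
  have same: "\<theta> k - \<theta> i = (\<theta> j - \<theta> i) + 2 * r * pi \<longleftrightarrow> real k - real j = r * N" for r
  proof -
    have "\<theta> k - \<theta> i - ((\<theta> j - \<theta> i) + 2 * r * pi) = 2 * pi / N * (real k - real j - r * N)"
      using N by (simp add: \<theta>_def field_simps)
    then show ?thesis using N by (smt (verit, best) divide_pos_pos mult_eq_0_iff pi_gt_zero)
  qed
  have refl: "\<theta> k - \<theta> i = - (\<theta> j - \<theta> i) + 2 * r * pi \<longleftrightarrow>
      real j + real k - 2 * real i = r * N" for r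
  proof -
    have "\<theta> k - \<theta> i - (- (\<theta> j - \<theta> i) + 2 * r * pi) =
        2 * pi / N * (real j + real k - 2 * real i - r * N)"
      using N by (simp add: \<theta>_def field_simps)
    then show ?thesis using N by (smt (verit, best) divide_pos_pos mult_eq_0_iff pi_gt_zero)
  qed
  have "orthogonal (group_pos q k - group_pos q j) (group_pos q i - group_pos q 1) \<longleftrightarrow>
      cos (\<theta> k - \<theta> i) = cos (\<theta> j - \<theta> i)"
    using assms pos pos1 by (simp add: orthogonal_cis_diff_iff)
  also have "\<dots> \<longleftrightarrow> (\<exists>r\<in>\<int>. real k - real j = r * N \<or> real j + real k - 2 * real i = r * N)"
    by (simp only: cos_eq same refl)
  also have "\<dots> \<longleftrightarrow> (\<exists>r::int. int k - int j = r * int (2 * q - 1)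
      \<or> int j + int k - 2 * int i = r * int (2 * q - 1))"
  proof -
    have "real k - real j = of_int r * N \<longleftrightarrow> int k - int j = r * int (2 * q - 1)" for r
      unfolding N_def by (subst of_int_eq_iff[where 'a=real, symmetric]) (simp del: of_int_eq_iff)
    moreover have "real j + real k - 2 * real i = of_int r * N \<longleftrightarrow>
        int j + int k - 2 * int i = r * int (2 * q - 1)" for r
      unfolding N_def by (subst of_int_eq_iff[where 'a=real, symmetric]) (simp del: of_int_eq_iff)
    ultimately show ?thesis by (auto simp: Ints_def)
  qed
  also have "\<dots> \<longleftrightarrow> [int k = int j] (mod int (2 * q - 1)) \<or>
      [int j + int k = 2 * int i] (mod int (2 * q - 1))"
    by (auto simp: cong_iff_dvd_diff dvd_def mult.commute)
  also have "\<dots> \<longleftrightarrow> [int j + int k = 2 * int i] (mod int (2 * q - 1))"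
    using cong_imp_eq_group[of k j q] assms by auto
  finally show ?thesis .
qed

lemma mem_slot_pairs_iff:
  assumes "i \<in> {2..2 * q}"
  shows "(j, k) \<in> slot_pairs q i \<longleftrightarrow> j = 1 \<and> k = i \<or>
    j \<in> {2..2 * q} - {i} \<and> k \<in> {2..2 * q} - {i} \<and> j \<noteq> k \<and>
    [int j + int k = 2 * int i] (mod int (2 * q - 1))"
  using orthogonal_group_pos_iff[OF assms] by (auto simp: slot_pairs_def)

section \<open>Combinatorics of the slot pairs, within one slot and across two successive
  ones\<close>

lemma slot_pairs_bounds:
  assumes "i \<in> {2..2 * q}" "(j, k) \<in> slot_pairs q i"
  shows "j \<in> {1..2 * q}" "k \<in> {1..2 * q}" "j \<noteq> k"
  using assms by (auto simp: slot_pairs_def)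

text \<open>The congruence determines the partner of a polygon group, and 1 and \<open>i\<close>
  occur only with each other. Unordered pairs are compared because \<open>slot_pairs\<close>
  contains both orders.\<close>

lemma slot_pairs_unique:
  assumes "i \<in> {2..2 * q}" "(j, k) \<in> slot_pairs q i" "(j', k') \<in> slot_pairs q i"
    and "{j, k} \<inter> {j', k'} \<noteq> {}"
  shows "{j, k} = {j', k'}"
proof -
  have eq: "b = b'" if "[int a + int b = 2 * int i] (mod int (2 * q - 1))"
      "[int a + int b' = 2 * int i] (mod int (2 * q - 1))" "b \<in> {2..2 * q}" "b' \<in> {2..2 * q}"
    for a b b'
  proof (rule cong_imp_eq_group[OF _ that(3,4)])
    have "[int a + int b = int a + int b'] (mod int (2 * q - 1))"
      using that(1,2) cong_sym cong_trans by blast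
    then show "[int b = int b'] (mod int (2 * q - 1))" by (simp only: cong_add_lcancel)
  qed
  have pair: "a = 1 \<and> b = i \<or> a = i \<and> b = 1 \<or> a \<in> {2..2 * q} - {i} \<and> b \<in> {2..2 * q} - {i} \<and>
      [int a + int b = 2 * int i] (mod int (2 * q - 1))"
    if "(a, b) \<in> slot_pairs q i \<or> (b, a) \<in> slot_pairs q i" for a b
    using that unfolding mem_slot_pairs_iff[OF assms(1)] add.commute[of "int b" "int a"] by blast
  have partner: "b = b'"
    if "(a, b) \<in> slot_pairs q i \<or> (b, a) \<in> slot_pairs q i"
      "(a, b') \<in> slot_pairs q i \<or> (b', a) \<in> slot_pairs q i" for a b b'
    using pair[OF that(1)] pair[OF that(2)] eq[of a b b'] assms(1) by force
  obtain a where a: "a \<in> {j, k}" "a \<in> {j', k'}" using assms(4) by blast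
  obtain b where b: "{j, k} = {a, b}" "(a, b) \<in> slot_pairs q i \<or> (b, a) \<in> slot_pairs q i"
    using a(1) assms(2) by blast
  obtain b' where b': "{j', k'} = {a, b'}" "(a, b') \<in> slot_pairs q i \<or> (b', a) \<in> slot_pairs q i"
    using a(2) assms(3) by blast
  show ?thesis using partner[OF b(2) b'(2)] b(1) b'(1) by simp
qed

text \<open>The label in \<open>{2..2 * q}\<close> representing the residue class of
  \<open>x\<close>. It lets reflections and translations be computed on all integers.\<close>

definition group_of :: "nat \<Rightarrow> int \<Rightarrow> nat" where
  "group_of q x = 2 + nat ((x - 2) mod int (2 * q - 1))"

lemma group_of_mem: "q > 0 \<Longrightarrow> group_of q x \<in> {2..2 * q}"
proof -
  assume "q > 0"
  then have "(x - 2) mod int (2 * q - 1) < int (2 * q - 1)" "(x - 2) mod int (2 * q - 1) \<ge> 0" by auto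
  then show ?thesis by (simp only: group_of_def atLeastAtMost_iff) linarith
qed

lemma cong_group_of: "q > 0 \<Longrightarrow> [int (group_of q x) = x] (mod int (2 * q - 1))"
proof -
  assume "q > 0"
  then have "int (group_of q x) = 2 + (x - 2) mod int (2 * q - 1)" by (simp add: group_of_def)
  moreover have "[2 + (x - 2) mod int (2 * q - 1) = 2 + (x - 2)] (mod int (2 * q - 1))"
    by (intro cong_add) auto
  ultimately show ?thesis by simp
qed

lemma group_of_cong: "[x = y] (mod int (2 * q - 1)) \<Longrightarrow> group_of q x = group_of q y"
proof -
  assume "[x = y] (mod int (2 * q - 1))"
  then have "[x - 2 = y - 2] (mod int (2 * q - 1))" by (intro cong_diff) auto
  then show ?thesis by (simp add: group_of_def cong_def)
qed

lemma group_of_int: "j \<in> {2..2 * q} \<Longrightarrow> group_of q (int j) = j"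
  by (rule cong_imp_eq_group[OF cong_group_of group_of_mem]) auto

text \<open>The reflected label must differ from both \<open>i\<close> and \<open>j\<close>. Being
  \<open>i\<close> would give \<open>j\<close> congruent to \<open>i\<close> directly; being
  \<open>j\<close> would give it after cancelling 2, which is possible as the modulus is
  odd.\<close>

lemma group_of_reflect_mem_slot_pairs:
  assumes "i \<in> {2..2 * q}" "j \<in> {2..2 * q}" "j \<noteq> i"
  shows "(j, group_of q (2 * int i - int j)) \<in> slot_pairs q i"
proof -
  let ?N = "int (2 * q - 1)" and ?k = "group_of q (2 * int i - int j)"
  have q: "q > 0" using assms(1) by auto
  have k: "[int ?k = 2 * int i - int j] (mod ?N)" by (rule cong_group_of[OF q])
  have not: "\<not> [int j = int i] (mod ?N)" using cong_imp_eq_group assms by blast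
  have sum: "[int j + int ?k = 2 * int i] (mod ?N)"
    using cong_add[OF cong_refl[of "int j"] k] by simp
  have "?k \<noteq> i"
  proof
    assume "?k = i"
    then have "[int j + int i = 2 * int i] (mod ?N)" using sum by simp
    then have "[int j = int i] (mod ?N)"
      by (simp add: cong_iff_dvd_diff)
    with not show False ..
  qed
  moreover have "?k \<noteq> j"
  proof
    assume "?k = j"
    then have "[2 * int j = 2 * int i] (mod ?N)" using sum by simp
    with not show False using cong_double_imp_cong[OF _ q] by blast
  qed
  ultimately show ?thesis
    using sum assms group_of_mem[OF q] by (auto simp: mem_slot_pairs_iff[OF assms(1)])
qed

lemma slot_pairs_cover:
  assumes "i \<in> {2..2 * q}" "j \<in> {1..2 * q}"
  obtains a b where "(a, b) \<in> slot_pairs q i" "j \<in> {a, b}"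
proof (cases "j = 1 \<or> j = i")
  case True
  then show ?thesis using that[of 1 i] by (auto simp: slot_pairs_def)
next
  case False
  then show ?thesis using that[OF group_of_reflect_mem_slot_pairs[OF assms(1), of j]] assms(2) by auto
qed

text \<open>A property respected by the pairs of both slots is invariant under translation by 2,
  hence constant on the polygon; the pair \<open>(1, i)\<close> carries it to the centre. It is
  applied to the property of meeting a given set of peers.\<close>

lemma consecutive_slots_connected:
  assumes i: "i \<in> {2..2 * q}" and i': "i' \<in> {2..2 * q}"
    and succ: "[int i' = int i + 1] (mod int (2 * q - 1))"
    and P: "\<And>j k. (j, k) \<in> slot_pairs q i \<Longrightarrow> P j \<longleftrightarrow> P k"
    and P': "\<And>j k. (j, k) \<in> slot_pairs q i' \<Longrightarrow> P j \<longleftrightarrow> P k"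
    and j: "j \<in> {1..2 * q}"
  shows "P j \<longleftrightarrow> P 1"
proof -
  let ?N = "int (2 * q - 1)"
  have q: "q > 0" using i by auto
  \<comment> \<open>The periodic extension of \<open>P\<close> from the polygon labels to all
    integers.\<close>
  define Q where "Q = (\<lambda>x. P (group_of q x))"
  have reflect: "Q x \<longleftrightarrow> Q (2 * int h - x)"
    if h: "h \<in> {2..2 * q}" and R: "\<And>j k. (j, k) \<in> slot_pairs q h \<Longrightarrow> P j \<longleftrightarrow> P k" for h x
  proof -
    have x: "[int (group_of q x) = x] (mod ?N)" by (rule cong_group_of[OF q])
    have eq: "group_of q (2 * int h - int (group_of q x)) = group_of q (2 * int h - x)"
      by (intro group_of_cong cong_diff x) auto
    show ?thesis
    proof (cases "group_of q x = h")
      \<comment> \<open>The fixed point \<open>h\<close> has no partner on the polygon, but there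
        both sides coincide.\<close>
      case True
      then show ?thesis using eq group_of_int[OF h] by (simp add: Q_def)
    next
      case False
      then show ?thesis
        using R[OF group_of_reflect_mem_slot_pairs[OF h group_of_mem[OF q]]] eq
        by (simp add: Q_def)
    qed
  qed
  have step: "Q (x + 2) \<longleftrightarrow> Q x" for x
  proof -
    have "Q x \<longleftrightarrow> Q (2 * int i' - (2 * int i - x))"
      using reflect[OF i P, of x] reflect[OF i' P', of "2 * int i - x"] by blast
    moreover have "[2 * int i' - (2 * int i - x) = 2 * (int i + 1) - (2 * int i - x)] (mod ?N)"
      by (intro cong_diff cong_mult succ) auto
    then have "Q (2 * int i' - (2 * int i - x)) \<longleftrightarrow> Q (2 * (int i + 1) - (2 * int i - x))"
      unfolding Q_def using group_of_cong by metis
    moreover have "2 * (int i + 1) - (2 * int i - x) = x + 2" by simp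
    ultimately show ?thesis by metis
  qed
  have shift: "Q (int i + 2 * int l) \<longleftrightarrow> Q (int i)" for l
  proof (induction l)
    case (Suc l)
    have "int i + 2 * int (Suc l) = int i + 2 * int l + 2" by simp
    then show ?case using step[of "int i + 2 * int l"] Suc by metis
  qed simp
  have "P i \<longleftrightarrow> P 1" using P[of 1 i] by (simp add: slot_pairs_def)
  then have Qi: "Q (int i) \<longleftrightarrow> P 1" by (simp add: Q_def group_of_int[OF i])
  show ?thesis
  proof (cases "j = 1")
    case False
    then have j2: "j \<in> {2..2 * q}" using j by auto
    \<comment> \<open>Since \<open>2 * q\<close> is 1 more than the modulus, \<open>q\<close>
      inverts 2; thus \<open>l\<close> translations by 2 lead from \<open>i\<close> to
      \<open>j\<close>.\<close>
    define l where "l = nat (((int j - int i) * int q) mod ?N)"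
    have "[int l = (int j - int i) * int q] (mod ?N)" using q by (simp add: l_def)
    then have "[int i + 2 * int l = int i + 2 * ((int j - int i) * int q)] (mod ?N)"
      by (intro cong_add cong_mult) auto
    moreover have "int i + 2 * ((int j - int i) * int q) = int j + (int j - int i) * ?N"
      using q by (simp add: of_nat_diff algebra_simps)
    ultimately have "[int i + 2 * int l = int j] (mod ?N)" by (simp add: cong_def)
    then have "Q (int j) \<longleftrightarrow> Q (int i + 2 * int l)"
      unfolding Q_def using group_of_cong by metis
    then show ?thesis using shift Qi group_of_int[OF j2] by (simp add: Q_def)
  qed simp
qed

lemma slot_index_mem: "q > 0 \<Longrightarrow> slot_index q t \<in> {2..2 * q}"
proof -
  assume "q > 0"
  then have "t mod (2 * q - 1) < 2 * q - 1" by simp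
  then show ?thesis unfolding slot_index_def by auto
qed

text \<open>As a congruence this also covers the restart of the loop, where the index drops from
  \<open>2 * q\<close> to 2.\<close>

lemma slot_index_Suc_cong:
  "[int (slot_index q (Suc t)) = int (slot_index q t) + 1] (mod int (2 * q - 1))"
proof -
  have cong: "[slot_index q s = 2 + s] (mod (2 * q - 1))" for s
    unfolding slot_index_def by (intro cong_add) auto
  have "[slot_index q t + 1 = 2 + Suc t] (mod (2 * q - 1))"
    using cong_add[OF cong[of t] cong_refl[of 1]] by simp
  then have "[slot_index q (Suc t) = slot_index q t + 1] (mod (2 * q - 1))"
    using cong[of "Suc t"] cong_sym cong_trans by blast
  then show ?thesis by (simp flip: cong_int_iff add: add.commute)
qed

section \<open>Zones as sets of peers, and the sets consistent with them\<close>

lemma consistent_corruptionD: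
  assumes "consistent_corruption (cyclic_zones q \<nu> t) X"
    and "(j, k) \<in> slot_pairs q (slot_index q t)" and "(\<nu> j \<union> \<nu> k) \<inter> X \<noteq> {}"
  shows "\<nu> j \<union> \<nu> k \<subseteq> X"
  using assms by (force simp: consistent_corruption_def cyclic_zones_def)

context
  fixes q h :: nat and \<nu> :: "nat \<Rightarrow> 'p set"
  assumes q: "q > 0" and h: "h > 0"
    and disj: "disjoint_family_on \<nu> {1..2 * q}"
    and card_group: "\<And>j. j \<in> {1..2 * q} \<Longrightarrow> card (\<nu> j) = h"
begin

lemma finite_group: "j \<in> {1..2 * q} \<Longrightarrow> finite (\<nu> j)"
  using card_group h card_ge_0_finite by force

lemma group_nonempty: "j \<in> {1..2 * q} \<Longrightarrow> \<nu> j \<noteq> {}"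
  using card_group h by force

lemma card_zone:
  assumes "Z \<in> cyclic_zones q \<nu> t" shows "card Z = 2 * h"
proof -
  obtain j k where jk: "(j, k) \<in> slot_pairs q (slot_index q t)" and Z: "Z = \<nu> j \<union> \<nu> k"
    using assms by (auto simp: cyclic_zones_def)
  note b = slot_pairs_bounds[OF slot_index_mem[OF q] jk]
  have "\<nu> j \<inter> \<nu> k = {}" using disj b by (auto simp: disjoint_family_on_def)
  then show ?thesis using b by (simp add: Z card_Un_disjoint finite_group card_group)
qed

lemma zones_disjoint:
  assumes "Z \<in> cyclic_zones q \<nu> t" "Z' \<in> cyclic_zones q \<nu> t" "Z \<noteq> Z'"
  shows "Z \<inter> Z' = {}"
proof (rule ccontr)
  assume ne: "Z \<inter> Z' \<noteq> {}"
  obtain j k where jk: "(j, k) \<in> slot_pairs q (slot_index q t)" and Z: "Z = \<nu> j \<union> \<nu> k"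
    using assms by (auto simp: cyclic_zones_def)
  obtain j' k' where jk': "(j', k') \<in> slot_pairs q (slot_index q t)" and Z': "Z' = \<nu> j' \<union> \<nu> k'"
    using assms by (auto simp: cyclic_zones_def)
  note b = slot_pairs_bounds[OF slot_index_mem[OF q] jk]
    slot_pairs_bounds[OF slot_index_mem[OF q] jk']
  obtain a c where ac: "a \<in> {j, k}" "c \<in> {j', k'}" "\<nu> a \<inter> \<nu> c \<noteq> {}"
    using ne Z Z' by blast
  moreover have "a \<in> {1..2 * q}" "c \<in> {1..2 * q}" using ac(1,2) b by blast+
  ultimately have "a = c" using disj unfolding disjoint_family_on_def by blast
  then have "{j, k} = {j', k'}"
    using slot_pairs_unique[OF slot_index_mem[OF q] jk jk'] ac by blast
  then have "Z = Z'" unfolding Z Z' by (auto simp: doubleton_eq_iff)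
  with assms(3) show False ..
qed

lemma zones_cover:
  assumes "x \<in> (\<Union>j\<in>{1..2 * q}. \<nu> j)"
  obtains Z where "Z \<in> cyclic_zones q \<nu> t" "x \<in> Z"
proof -
  obtain j where j: "j \<in> {1..2 * q}" "x \<in> \<nu> j" using assms by auto
  obtain a b where "(a, b) \<in> slot_pairs q (slot_index q t)" "j \<in> {a, b}"
    using slot_pairs_cover[OF slot_index_mem[OF q] j(1)] .
  then show ?thesis using that[of "\<nu> a \<union> \<nu> b"] j(2) by (force simp: cyclic_zones_def)
qed

text \<open>By disjointness, a zone meeting the union is one of its members. This makes the original
  corruption consistent with its own slot.\<close>

lemma consistent_Union_zones:
  assumes "\<Z> \<subseteq> cyclic_zones q \<nu> t"
  shows "consistent_corruption (cyclic_zones q \<nu> t) (\<Union>\<Z>)"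
  unfolding consistent_corruption_def
proof (intro ballI impI)
  fix Z assume Z: "Z \<in> cyclic_zones q \<nu> t" "Z \<inter> \<Union>\<Z> \<noteq> {}"
  then obtain Z' where "Z' \<in> \<Z>" "Z \<inter> Z' \<noteq> {}" by blast
  then show "Z \<subseteq> \<Union>\<Z>" using zones_disjoint[OF Z(1), of Z'] assms by blast
qed

text \<open>A consistent set is the disjoint union of the zones it meets, each of size
  \<open>2 * h\<close>.\<close>

lemma consistent_card_dvd:
  assumes "consistent_corruption (cyclic_zones q \<nu> t) X"
    and "X \<subseteq> (\<Union>j\<in>{1..2 * q}. \<nu> j)"
  shows "2 * h dvd card X"
proof -
  define \<Z> where "\<Z> = {Z \<in> cyclic_zones q \<nu> t. Z \<inter> X \<noteq> {}}"
  have X: "X = \<Union>\<Z>"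
  proof
    show "X \<subseteq> \<Union>\<Z>"
    proof
      fix x assume x: "x \<in> X"
      then obtain Z where "Z \<in> cyclic_zones q \<nu> t" "x \<in> Z" using zones_cover assms(2) by blast
      with x show "x \<in> \<Union>\<Z>" by (auto simp: \<Z>_def)
    qed
    show "\<Union>\<Z> \<subseteq> X" using assms(1) by (auto simp: \<Z>_def consistent_corruption_def)
  qed
  have "finite X" using assms(2) finite_group finite_subset by blast
  then show ?thesis
    unfolding X by (intro dvd_partition) (auto simp: \<Z>_def dest: card_zone zones_disjoint)
qed

lemma consistent_both_slots_imp_all:
  assumes X: "consistent_corruption (cyclic_zones q \<nu> t) X"
      "consistent_corruption (cyclic_zones q \<nu> (Suc t)) X"
    and sub: "X \<subseteq> (\<Union>j\<in>{1..2 * q}. \<nu> j)" and ne: "X \<noteq> {}"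
  shows "X = (\<Union>j\<in>{1..2 * q}. \<nu> j)"
proof
  let ?P = "\<lambda>j. \<nu> j \<inter> X \<noteq> {}"
  \<comment> \<open>If one group of a pair meets \<open>X\<close>, the whole zone lies in
    \<open>X\<close>; as groups are nonempty, the other group meets \<open>X\<close> too.\<close>
  have iff: "?P j \<longleftrightarrow> ?P k"
    if s: "consistent_corruption (cyclic_zones q \<nu> s) X" "(j, k) \<in> slot_pairs q (slot_index q s)"
    for s j k
    using consistent_corruptionD[OF s] group_nonempty slot_pairs_bounds[OF slot_index_mem[OF q] s(2)]
    by blast
  have all: "?P j \<longleftrightarrow> ?P 1" if "j \<in> {1..2 * q}" for j
    using consecutive_slots_connected[where P = ?P, OF slot_index_mem[OF q] slot_index_mem[OF q]
      slot_index_Suc_cong iff[OF X(1)] iff[OF X(2)] that] .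
  obtain j0 where "j0 \<in> {1..2 * q}" "?P j0" using sub ne by blast
  then have P: "?P j" if "j \<in> {1..2 * q}" for j using all that by blast
  show "(\<Union>j\<in>{1..2 * q}. \<nu> j) \<subseteq> X"
  proof
    fix x assume "x \<in> (\<Union>j\<in>{1..2 * q}. \<nu> j)"
    then obtain j where j: "j \<in> {1..2 * q}" "x \<in> \<nu> j" by auto
    \<comment> \<open>Every group now meets \<open>X\<close>, so consistency with a single slot
      already puts each zone inside \<open>X\<close>.\<close>
    obtain a b where ab: "(a, b) \<in> slot_pairs q (slot_index q t)" "j \<in> {a, b}"
      using slot_pairs_cover[OF slot_index_mem[OF q] j(1)] .
    have "(\<nu> a \<union> \<nu> b) \<inter> X \<noteq> {}" using P[OF j(1)] ab(2) by blast
    then have "\<nu> a \<union> \<nu> b \<subseteq> X" by (rule consistent_corruptionD[OF X(1) ab(1)])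
    with ab(2) j(2) show "x \<in> X" by blast
  qed
qed (fact sub)

end

section \<open>Counting the newly corrupted peers\<close>

theorem lemma8:
  fixes peers :: "'p set" and n m n' t K :: nat
    and \<nu> :: "nat \<Rightarrow> 'p set" and C :: "nat \<Rightarrow> 'p set"
  assumes "finite peers" and "card peers = n" and "n > 0"
    and "even m" and "m dvd n" and "n' = n div m"
    and "(\<Union>j\<in>{1..2 * n'}. \<nu> j) = peers"
    and "disjoint_family_on \<nu> {1..2 * n'}"
    and "\<And>j. j \<in> {1..2 * n'} \<Longrightarrow> card (\<nu> j) = m div 2"
    and "consistent_attack peers (cyclic_zones n' \<nu>) t K C"
  shows "\<forall>k<K. C k \<noteq> peers \<longrightarrow> card (C (Suc k) - C k) \<ge> m"
proof (intro allI impI)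
  fix k assume k: "k < K" and not_all: "C k \<noteq> peers"
  \<comment> \<open>A divisor of the positive \<open>n\<close> is nonzero, and evenness makes the
    halving exact.\<close>
  have m: "m > 0" "2 * (m div 2) = m" using assms(3-5) by (auto intro!: Nat.gr0I)
  have n': "n' > 0" using assms(3,5,6) m(1) by (auto simp: dvd_imp_le div_greater_zero_iff)
  have h: "m div 2 > 0" using m by linarith
  note zones = n' h assms(8,9)
  note attack = assms(10)[unfolded consistent_attack_def corrupts_transaction_def]
  obtain \<Z> where \<Z>: "\<Z> \<subseteq> cyclic_zones n' \<nu> t" "C 0 = \<Union>\<Z>" "real (card (C 0)) \<ge> real n / 2"
    using attack assms(2) by blast
  have "C 0 \<noteq> {}" using \<Z>(3) assms(3) by auto
  have steps: "C l \<subseteq> C (Suc l)" "C (Suc l) \<subseteq> peers"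
      "consistent_corruption (cyclic_zones n' \<nu> (t + Suc l)) (C (Suc l))" if "l < K" for l
    using attack that by auto
  have mono: "l \<le> K \<Longrightarrow> C 0 \<subseteq> C l" for l
  proof (induction l)
    case (Suc l)
    then show ?case using steps(1)[of l] by auto
  qed simp
  have ne: "C k \<noteq> {}" using mono[of k] k \<open>C 0 \<noteq> {}\<close> by auto
  \<comment> \<open>For \<open>k = 0\<close> consistency comes from \<open>C 0\<close> being a union
    of zones, afterwards from the previous step of the attack.\<close>
  have cons: "consistent_corruption (cyclic_zones n' \<nu> (t + k)) (C k)"
  proof (cases k)
    case 0
    then show ?thesis using consistent_Union_zones[OF zones \<Z>(1)] \<Z>(2) by simp
  next
    case (Suc l)
    then show ?thesis using steps(3)[of l] k by simp
  qed
  note nxt = steps[OF k]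
  have sub: "C k \<subseteq> peers" using nxt(1,2) by blast
  \<comment> \<open>Otherwise \<open>C k\<close> would be consistent with two successive slots and
    hence contain all peers.\<close>
  have "C (Suc k) \<noteq> C k"
    using consistent_both_slots_imp_all[OF zones cons _ _ ne] nxt(3) sub assms(7) not_all by auto
  then have "C (Suc k) - C k \<noteq> {}" using nxt(1) by blast
  moreover have fin: "finite (C (Suc k))" using nxt(2) assms(1) finite_subset by blast
  ultimately have pos: "card (C (Suc k) - C k) > 0" by (simp add: card_gt_0_iff)
  \<comment> \<open>Both sizes are multiples of \<open>m\<close>, so the strict increase is a
    positive multiple of \<open>m\<close>.\<close>
  have "m dvd card (C k)" "m dvd card (C (Suc k))"
    using consistent_card_dvd[OF zones cons] consistent_card_dvd[OF zones nxt(3)]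
      sub nxt(2) assms(7) m(2) by auto
  moreover have "card (C (Suc k) - C k) = card (C (Suc k)) - card (C k)"
    using fin nxt(1) by (intro card_Diff_subset) (auto intro: finite_subset)
  ultimately have "m dvd card (C (Suc k) - C k)" by (simp add: dvd_diff_nat)
  then show "card (C (Suc k) - C k) \<ge> m" using pos by (rule dvd_imp_le)
qed

end
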